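(* Let $k\ge1$ be a fixed constant and let $\mathcal P:\{0,1\}^{\binom nk}\to\{0,1\}$ be a non-constant $k$-uniform hypergraph property on vertex set $[n]$. Let $M(\mathcal P)=\max\{\mathsf N(\mathcal P),\mathsf N(\overline{\mathcal P})\}$. Then $M(\mathcal P)\ge\Omega(n^{1/6})$.
   Context: $k$-uniform hypergraphs on vertex set $[n]=\{1,\dots,n\}$ are identified with $\{0,1\}^{\binom nk}$ (one coordinate per $k$-subset, indicating whether it is a hyperedge). A $k$-uniform hypergraph property is a function $\mathcal P$ on such hypergraphs with $\mathcal P(H_1)=\mathcal P(H_2)$ whenever $H_1,H_2$ are isomorphic (related by a permutation of $[n]$). $\mathsf N(g)$ is the minimum degree of a real polynomial $p$ with $|p(x)|\le1/3$ whenever $g(x)=0$ and $|p(x)|\ge1$ whenever $g(x)=1$; $\overline{\mathcal P}=1-\mathcal P$. The constant in $\Omega(\cdot)$ may depend on $k$. *)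

theory Defs
  imports Complex_Main
begin

text \<open>The k-subsets of [n] = {1..n}; these index the coordinates of {0,1}^(n choose k).
  A k-uniform hypergraph on [n] is a set H of such k-subsets (coordinate S is 1 iff S \<in> H).\<close>
definition ksets :: "nat \<Rightarrow> nat \<Rightarrow> nat set set" where
  "ksets n k = {S. S \<subseteq> {1..n} \<and> card S = k}"

definition hypergraph_property :: "nat \<Rightarrow> nat \<Rightarrow> (nat set set \<Rightarrow> bool) \<Rightarrow> bool" where
  "hypergraph_property n k P \<longleftrightarrow>
     (\<forall>\<sigma> H. bij_betw \<sigma> {1..n} {1..n} \<and> H \<subseteq> ksets n k \<longrightarrow> P ((\<lambda>S. \<sigma> ` S) ` H) = P H)"

definition nonconstant_on :: "nat \<Rightarrow> nat \<Rightarrow> (nat set set \<Rightarrow> bool) \<Rightarrow> bool" where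
  "nonconstant_on n k P \<longleftrightarrow> (\<exists>H1 H2. H1 \<subseteq> ksets n k \<and> H2 \<subseteq> ksets n k \<and> P H1 \<noteq> P H2)"

text \<open>p, a real function on {0,1}^V (points = subsets H of V), is given by a real polynomial of
  degree \<le> d. On the Boolean cube every real polynomial agrees with a multilinear one of no larger
  degree, so this is: p H = \<Sum>_{T \<subseteq> V, |T| \<le> d} c_T \<Prod>_{i\<in>T} x_i, where x_i = [i \<in> H].\<close>
definition poly_deg_le :: "'a set \<Rightarrow> nat \<Rightarrow> ('a set \<Rightarrow> real) \<Rightarrow> bool" where
  "poly_deg_le V d p \<longleftrightarrow>
     (\<exists>c :: 'a set \<Rightarrow> real. \<forall>H. H \<subseteq> V \<longrightarrow>
        p H = (\<Sum>T\<in>{T. T \<subseteq> V \<and> card T \<le> d}. c T * (\<Prod>i\<in>T. if i \<in> H then 1 else 0)))"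

definition N_deg :: "'a set \<Rightarrow> ('a set \<Rightarrow> bool) \<Rightarrow> nat" where
  "N_deg V g = (LEAST d. \<exists>p. poly_deg_le V d p \<and>
       (\<forall>H. H \<subseteq> V \<and> \<not> g H \<longrightarrow> \<bar>p H\<bar> \<le> 1/3) \<and>
       (\<forall>H. H \<subseteq> V \<and> g H \<longrightarrow> \<bar>p H\<bar> \<ge> 1))"

definition M_deg :: "nat \<Rightarrow> nat \<Rightarrow> (nat set set \<Rightarrow> bool) \<Rightarrow> nat" where
  "M_deg n k P = max (N_deg (ksets n k) P) (N_deg (ksets n k) (\<lambda>H. \<not> P H))"

end

theory Submission
  imports Defs "HOL-Computational_Algebra.Polynomial"
begin

text \<open>
  Replacing the property by its negation, we may assume that the empty hypergraph lacks it. Let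
  \<open>H\<close> be a smallest hypergraph with the property, and \<open>D = 2 * M\<close>. On the subhypergraphs of
  \<open>H\<close> the property is a conjunction, so squaring and symmetrizing the polynomial for
  \<open>N\<close> gives a univariate polynomial of degree at most \<open>D\<close> that is at most
  \<open>1/9\<close> on \<open>0, \<dots>, |H| - 1\<close> and at least \<open>1\<close> at \<open>|H|\<close>; hence \<open>|H| \<le> 4D\<^sup>2\<close>.

  Now place \<open>m = n div w\<close> vertex-disjoint copies of \<open>H\<close>, where \<open>w \<le> k|H|\<close> is the number of
  non-isolated vertices of \<open>H\<close>. Whether a union of copies has the property depends only on
  the number of copies, and it differs between zero copies and one copy. The symmetrized polynomial
  crosses \<open>1/2\<close> at most \<open>D\<close> times, so if \<open>m \<ge> (D + 1)(4D\<^sup>2 + 1)\<close> there is a run of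
  \<open>4D\<^sup>2 + 1\<close> counts on which the property is constant. At the end of this run the polynomial
  for the property or the one for its negation would jump, after having been small on the run, which
  its degree forbids. Thus \<open>n < (m + 1) w\<close> is of order at most \<open>M^5\<close>.
\<close>

section \<open>Multilinear polynomials on the Boolean cube\<close>

text \<open>Moebius inversion over the subset lattice, by induction on the ground set: coefficients
  of sets avoiding the new point \<open>a\<close> come from \<open>p\<close> itself, those of sets
  containing \<open>a\<close> from the discrete derivative
  \<open>p (insert a H) - p H\<close>.\<close>

lemma ex_subset_sum_representation:
  fixes p :: "'a set \<Rightarrow> real"
  assumes "finite V"
  shows "\<exists>c. \<forall>H\<subseteq>V. p H = sum c (Pow H)"
  using assms
proof (induction V arbitrary: p rule: finite_induct)
  case empty
  show ?case by (rule exI[of _ p]) simp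
next
  case (insert a V)
  obtain c1 where c1: "\<forall>H\<subseteq>V. p H = sum c1 (Pow H)" using insert.IH by blast
  obtain c2 where c2: "\<forall>H\<subseteq>V. p (insert a H) - p H = sum c2 (Pow H)"
    using insert.IH[of "\<lambda>H. p (insert a H) - p H"] by blast
  define c where "c = (\<lambda>T. if a \<in> T then c2 (T - {a}) else c1 T)"
  have old: "sum c (Pow H) = p H" if "H \<subseteq> V" for H
  proof -
    have "sum c (Pow H) = sum c1 (Pow H)"
      using that insert.hyps by (intro sum.cong) (auto simp: c_def)
    then show ?thesis using c1 that by simp
  qed
  have new: "sum c (Pow (insert a H)) = p (insert a H)" if "H \<subseteq> V" for H
  proof -
    have a: "a \<notin> H" and fin: "finite H"
      using that insert.hyps by (auto intro: finite_subset)
    have "sum c (Pow (insert a H)) = sum c (Pow H) + sum c (insert a ` Pow H)"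
      unfolding Pow_insert using a fin by (intro sum.union_disjoint) auto
    also have "sum c (insert a ` Pow H) = (\<Sum>T\<in>Pow H. c (insert a T))"
      using a by (subst sum.reindex) (auto simp: inj_on_def)
    also have "\<dots> = sum c2 (Pow H)"
      using a by (intro sum.cong) (auto simp: c_def intro!: arg_cong[of _ _ c2])
    also have "\<dots> = p (insert a H) - p H" using c2 that by simp
    finally show ?thesis using old[OF that] by simp
  qed
  have "p H = sum c (Pow H)" if "H \<subseteq> insert a V" for H
  proof (cases "a \<in> H")
    case True
    then have "H = insert a (H - {a})" "H - {a} \<subseteq> V" using that by auto
    then show ?thesis using new[of "H - {a}"] by simp
  next
    case False
    then have "H \<subseteq> V" using that by auto
    then show ?thesis using old by simp
  qed
  then show ?case by blast
qed

lemma prod_membership: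
  assumes "finite T"
  shows "(\<Prod>i\<in>T. if i \<in> H then 1 else 0 :: real) = of_bool (T \<subseteq> H)"
  using assms by (induction T rule: finite_induct) auto

text \<open>Shows that the \<open>LEAST\<close> in \<open>N_deg\<close> ranges over a nonempty set,
  so the minimum is attained by an actual polynomial.\<close>

lemma poly_deg_le_card:
  assumes "finite V"
  shows "poly_deg_le V (card V) p"
proof -
  obtain c where c: "\<forall>H\<subseteq>V. p H = sum c (Pow H)"
    using ex_subset_sum_representation[OF assms] by blast
  have "p H = (\<Sum>T\<in>{T. T \<subseteq> V \<and> card T \<le> card V}. c T * (\<Prod>i\<in>T. if i \<in> H then 1 else 0))"
    if "H \<subseteq> V" for H
  proof -
    have eq: "{T. T \<subseteq> V \<and> card T \<le> card V} = Pow V"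
      using assms by (auto intro: card_mono)
    have "(\<Sum>T\<in>Pow V. c T * (\<Prod>i\<in>T. if i \<in> H then 1 else 0))
        = (\<Sum>T\<in>Pow V. c T * of_bool (T \<subseteq> H))"
      using assms by (intro sum.cong refl) (metis PowD finite_subset prod_membership)
    also have "\<dots> = sum c (Pow H)"
      using that assms by (intro sum.mono_neutral_cong_right) auto
    finally have "(\<Sum>T\<in>Pow V. c T * (\<Prod>i\<in>T. if i \<in> H then 1 else 0)) = sum c (Pow H)" .
    then show ?thesis using c that eq by simp
  qed
  then show ?thesis unfolding poly_deg_le_def by blast
qed

lemma N_deg_attained:
  assumes "finite V"
  obtains p where "poly_deg_le V (N_deg V g) p"
    "\<And>H. H \<subseteq> V \<Longrightarrow> \<not> g H \<Longrightarrow> \<bar>p H\<bar> \<le> 1/3"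
    "\<And>H. H \<subseteq> V \<Longrightarrow> g H \<Longrightarrow> \<bar>p H\<bar> \<ge> 1"
proof -
  let ?R = "\<lambda>d. \<exists>p. poly_deg_le V d p \<and>
       (\<forall>H. H \<subseteq> V \<and> \<not> g H \<longrightarrow> \<bar>p H\<bar> \<le> 1/3) \<and>
       (\<forall>H. H \<subseteq> V \<and> g H \<longrightarrow> \<bar>p H\<bar> \<ge> 1)"
  have "?R (card V)"
    using poly_deg_le_card[OF assms, of "\<lambda>H. of_bool (g H)"]
    by (intro exI[of _ "\<lambda>H. of_bool (g H)"]) auto
  then have "?R (N_deg V g)" unfolding N_deg_def by (rule LeastI)
  then obtain p where "poly_deg_le V (N_deg V g) p"
    "\<forall>H. H \<subseteq> V \<and> \<not> g H \<longrightarrow> \<bar>p H\<bar> \<le> 1/3" "\<forall>H. H \<subseteq> V \<and> g H \<longrightarrow> \<bar>p H\<bar> \<ge> 1"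
    by (elim exE conjE)
  then show ?thesis by (intro that[of p]) simp_all
qed

section \<open>Symmetrization to univariate polynomials\<close>

definition choose_poly :: "nat \<Rightarrow> real poly" where
  "choose_poly t = smult (1 / fact t) (\<Prod>i<t. [:- real i, 1:])"

lemma poly_choose_poly: "poly (choose_poly t) (real j) = real (j choose t)"
proof -
  have "real (j choose t) = (\<Prod>i = 0..<t. real j - real i) / fact t"
    by (simp only: binomial_gbinomial gbinomial_prod_rev)
  then show ?thesis by (simp add: choose_poly_def poly_prod atLeast0LessThan)
qed

lemma degree_choose_poly: "degree (choose_poly t) \<le> t"
proof -
  have "degree (\<Prod>i<t. [:- real i, 1:]) \<le> (\<Sum>i<t. degree [:- real i, 1:])"
    by (rule order.trans[OF degree_prod_sum_le]) auto
  then show ?thesis by (simp add: choose_poly_def)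
qed

text \<open>Deleting \<open>U\<close> from \<open>X\<close> leaves a
  \<open>(j - card U)\<close>-subset of \<open>A - U\<close>, and the product form is then the
  identity \<open>choose_mult\<close>. Its use: the average of the monomial of \<open>U\<close> over
  all \<open>j\<close>-subsets of \<open>A\<close> is
  \<open>(j choose card U) / (card A choose card U)\<close>, a polynomial in
  \<open>j\<close>.\<close>

lemma card_supersets_of_card:
  assumes "finite A" "U \<subseteq> A" "j \<le> card A"
  shows "card {X. X \<subseteq> A \<and> card X = j \<and> U \<subseteq> X} * (card A choose card U)
    = (card A choose j) * (j choose card U)"
proof (cases "card U \<le> j")
  case True
  have fU: "finite U" using assms finite_subset by blast
  have "bij_betw (\<lambda>Y. Y \<union> U) {Y. Y \<subseteq> A - U \<and> card Y = j - card U}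
      {X. X \<subseteq> A \<and> card X = j \<and> U \<subseteq> X}"
  proof (rule bij_betw_byWitness[where f' = "\<lambda>X. X - U"])
    show "(\<lambda>Y. Y \<union> U) ` {Y. Y \<subseteq> A - U \<and> card Y = j - card U}
        \<subseteq> {X. X \<subseteq> A \<and> card X = j \<and> U \<subseteq> X}"
    proof (rule image_subsetI)
      fix Y assume "Y \<in> {Y. Y \<subseteq> A - U \<and> card Y = j - card U}"
      then have Y: "Y \<subseteq> A - U" "card Y = j - card U" by auto
      then have "finite Y" using assms(1) by (meson finite_Diff finite_subset)
      moreover have "Y \<inter> U = {}" using Y by blast
      ultimately have "card (Y \<union> U) = j" using Y True fU by (simp add: card_Un_disjoint)
      then show "Y \<union> U \<in> {X. X \<subseteq> A \<and> card X = j \<and> U \<subseteq> X}"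
        using Y assms(2) by auto
    qed
    show "(\<lambda>X. X - U) ` {X. X \<subseteq> A \<and> card X = j \<and> U \<subseteq> X}
        \<subseteq> {Y. Y \<subseteq> A - U \<and> card Y = j - card U}"
      using fU by (auto simp: card_Diff_subset)
  qed auto
  then have "card {X. X \<subseteq> A \<and> card X = j \<and> U \<subseteq> X}
      = card {Y. Y \<subseteq> A - U \<and> card Y = j - card U}"
    by (simp add: bij_betw_same_card)
  also have "\<dots> = (card A - card U) choose (j - card U)"
    using assms fU by (simp add: n_subsets card_Diff_subset)
  finally show ?thesis
    using choose_mult[OF True assms(3)] by (simp add: mult.commute)
next
  case False
  have "{X. X \<subseteq> A \<and> card X = j \<and> U \<subseteq> X} = {}"
  proof (rule equals0I)
    fix X assume "X \<in> {X. X \<subseteq> A \<and> card X = j \<and> U \<subseteq> X}"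
    then show False using False card_mono[of X U] finite_subset[of X A] assms(1) by auto
  qed
  then have "card {X. X \<subseteq> A \<and> card X = j \<and> U \<subseteq> X} = 0" by (simp only: card.empty)
  then show ?thesis using False by (simp add: binomial_eq_0)
qed

text \<open>Minsky--Papert symmetrization of the square of a polynomial, after the substitution that
  identifies the variables in each fibre of \<open>\<beta>\<close> and sets those outside \<open>V'\<close> to zero.\<close>
lemma symmetrization_of_square:
  fixes p :: "'a set \<Rightarrow> real" and \<beta> :: "'a \<Rightarrow> 'b"
  assumes "finite V" "poly_deg_le V d p" "V' \<subseteq> V" "\<beta> ` V' \<subseteq> A" "finite A"
  shows "\<exists>Q::real poly. degree Q \<le> 2 * d \<and> (\<forall>j\<le>card A.
    real (card A choose j) * poly Q (real j) = (\<Sum>X | X \<subseteq> A \<and> card X = j. (p {i \<in> V'. \<beta> i \<in> X})\<^sup>2))"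
proof -
  obtain c where c: "\<And>H. H \<subseteq> V \<Longrightarrow>
      p H = (\<Sum>T\<in>{T. T \<subseteq> V \<and> card T \<le> d}. c T * (\<Prod>i\<in>T. if i \<in> H then 1 else 0))"
    using assms(2) unfolding poly_deg_le_def by blast
  define \<T> where "\<T> = {T. T \<subseteq> V \<and> card T \<le> d}"
  define U where "U = (\<lambda>z::'a set \<times> 'a set. fst z \<union> snd z)"
  \<comment> \<open>Expanding the square gives products of two monomials, and \<open>U z\<close> is
    the set of variables in such a product. The product vanishes if one of its variables is set to
    zero; otherwise identifying variables leaves \<open>t z\<close> of them.\<close>
  define e where "e = (\<lambda>z. c (fst z) * c (snd z) * of_bool (U z \<subseteq> V'))"
  define t where "t = (\<lambda>z. card (\<beta> ` U z))"
  \<comment> \<open>Each monomial is replaced by its average over the \<open>j\<close>-subsets. The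
    denominator can be zero only if \<open>U z\<close> is not inside \<open>V'\<close>, and then
    \<open>e z = 0\<close>.\<close>
  define Q where "Q = (\<Sum>z\<in>\<T> \<times> \<T>. smult (e z / real (card A choose t z)) (choose_poly (t z)))"
  have finT: "finite T" if "T \<in> \<T>" for T
    using that assms(1) by (auto simp: \<T>_def intro: finite_subset)
  have t_le: "t z \<le> 2 * d" if "z \<in> \<T> \<times> \<T>" for z
  proof -
    have "finite (U z)" using that finT by (auto simp: U_def)
    then have "t z \<le> card (U z)" unfolding t_def by (rule card_image_le)
    also have "\<dots> \<le> card (fst z) + card (snd z)" unfolding U_def by (rule card_Un_le)
    also have "\<dots> \<le> 2 * d" using that by (auto simp: \<T>_def)
    finally show ?thesis .
  qed
  have "degree Q \<le> 2 * d"
    unfolding Q_def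
  proof (rule degree_sum_le)
    show "finite (\<T> \<times> \<T>)" using assms(1) by (simp add: \<T>_def)
    fix z assume z: "z \<in> \<T> \<times> \<T>"
    have "degree (smult (e z / real (card A choose t z)) (choose_poly (t z))) \<le> t z"
      by (rule order.trans[OF degree_smult_le degree_choose_poly])
    then show "degree (smult (e z / real (card A choose t z)) (choose_poly (t z))) \<le> 2 * d"
      using t_le[OF z] by (rule order.trans)
  qed
  moreover have "real (card A choose j) * poly Q (real j)
      = (\<Sum>X | X \<subseteq> A \<and> card X = j. (p {i \<in> V'. \<beta> i \<in> X})\<^sup>2)" if j: "j \<le> card A" for j
  proof -
    have sq: "(p {i \<in> V'. \<beta> i \<in> X})\<^sup>2 = (\<Sum>z\<in>\<T> \<times> \<T>. e z * of_bool (\<beta> ` U z \<subseteq> X))" for X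
    proof -
      let ?G = "{i \<in> V'. \<beta> i \<in> X}"
      have "?G \<subseteq> V" using assms(3) by blast
      then have "p ?G = (\<Sum>T\<in>\<T>. c T * (\<Prod>i\<in>T. if i \<in> ?G then 1 else 0))"
        unfolding \<T>_def by (rule c)
      also have "\<dots> = (\<Sum>T\<in>\<T>. c T * of_bool (T \<subseteq> ?G))"
        using finT by (intro sum.cong refl) (simp only: prod_membership)
      finally have "p ?G = (\<Sum>T\<in>\<T>. c T * of_bool (T \<subseteq> ?G))" .
      then have "(p ?G)\<^sup>2 = (\<Sum>T\<in>\<T>. \<Sum>T'\<in>\<T>. (c T * of_bool (T \<subseteq> ?G)) * (c T' * of_bool (T' \<subseteq> ?G)))"
        by (simp add: power2_eq_square sum_product)
      also have "\<dots> = (\<Sum>z\<in>\<T> \<times> \<T>. (c (fst z) * of_bool (fst z \<subseteq> ?G)) * (c (snd z) * of_bool (snd z \<subseteq> ?G)))"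
        by (simp add: sum.cartesian_product case_prod_beta)
      also have "\<dots> = (\<Sum>z\<in>\<T> \<times> \<T>. e z * of_bool (\<beta> ` U z \<subseteq> X))"
        by (intro sum.cong refl) (auto simp: e_def U_def)
      finally show ?thesis .
    qed
    have coeff: "real (card A choose j) * (e z / real (card A choose t z) * real (j choose t z))
        = e z * real (card {X. X \<subseteq> A \<and> card X = j \<and> \<beta> ` U z \<subseteq> X})" for z
    proof (cases "U z \<subseteq> V'")
      case True
      then have sub: "\<beta> ` U z \<subseteq> A" using assms(4) by blast
      then have "t z \<le> card A" unfolding t_def using assms(5) card_mono by blast
      then have pos: "real (card A choose t z) > 0" by simp
      have "real (card {X. X \<subseteq> A \<and> card X = j \<and> \<beta> ` U z \<subseteq> X}) * real (card A choose t z)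
          = real (card A choose j) * real (j choose t z)"
        using card_supersets_of_card[OF assms(5) sub j] unfolding t_def
        by (metis of_nat_mult)
      then show ?thesis using pos by (simp add: field_simps)
    next
      case False
      then show ?thesis by (simp add: e_def)
    qed
    have "(\<Sum>X | X \<subseteq> A \<and> card X = j. (p {i \<in> V'. \<beta> i \<in> X})\<^sup>2)
        = (\<Sum>z\<in>\<T> \<times> \<T>. \<Sum>X | X \<subseteq> A \<and> card X = j. e z * of_bool (\<beta> ` U z \<subseteq> X))"
      unfolding sq by (rule sum.swap)
    also have "\<dots> = (\<Sum>z\<in>\<T> \<times> \<T>. e z * real (card {X. X \<subseteq> A \<and> card X = j \<and> \<beta> ` U z \<subseteq> X}))"
    proof (intro sum.cong refl)
      fix z
      have "(\<Sum>X | X \<subseteq> A \<and> card X = j. of_bool (\<beta> ` U z \<subseteq> X) :: real)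
          = (\<Sum>X | X \<subseteq> A \<and> card X = j \<and> \<beta> ` U z \<subseteq> X. 1)"
        using assms(5) by (intro sum.mono_neutral_cong_right) auto
      then show "(\<Sum>X | X \<subseteq> A \<and> card X = j. e z * of_bool (\<beta> ` U z \<subseteq> X))
          = e z * real (card {X. X \<subseteq> A \<and> card X = j \<and> \<beta> ` U z \<subseteq> X})"
        by (simp add: sum_distrib_left[symmetric])
    qed
    also have "\<dots> = real (card A choose j) * poly Q (real j)"
      by (simp only: Q_def poly_sum poly_smult poly_choose_poly sum_distrib_left coeff)
    finally show ?thesis by simp
  qed
  ultimately show ?thesis by blast
qed

text \<open>The threshold \<open>1/9\<close> is the square of the \<open>1/3\<close> in
  \<open>N_deg\<close>. As there, values are unbounded above where \<open>f\<close> holds.\<close>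

definition separates :: "nat \<Rightarrow> (nat \<Rightarrow> bool) \<Rightarrow> real poly \<Rightarrow> bool" where
  "separates m f Q \<longleftrightarrow>
     (\<forall>j\<le>m. (\<not> f j \<longrightarrow> 0 \<le> poly Q (real j) \<and> poly Q (real j) \<le> 1/9) \<and> (f j \<longrightarrow> 1 \<le> poly Q (real j)))"

text \<open>On sets \<open>X\<close> of one size \<open>g\<close> is constant, so \<open>Q\<close>
  at that size averages squares that are all at most \<open>1/9\<close> or all at least
  \<open>1\<close>. Squaring beforehand prevents large values of opposite sign from
  cancelling.\<close>

lemma symmetric_restriction_separates:
  fixes \<beta> :: "'a \<Rightarrow> 'b"
  assumes "finite V" "V' \<subseteq> V" "\<beta> ` V' \<subseteq> A" "finite A"
    and sym: "\<And>X. X \<subseteq> A \<Longrightarrow> g {i \<in> V'. \<beta> i \<in> X} = f (card X)"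
  obtains Q where "degree Q \<le> 2 * N_deg V g" "separates (card A) f Q"
proof -
  obtain p where p: "poly_deg_le V (N_deg V g) p"
    and small: "\<And>H. H \<subseteq> V \<Longrightarrow> \<not> g H \<Longrightarrow> \<bar>p H\<bar> \<le> 1/3"
    and large: "\<And>H. H \<subseteq> V \<Longrightarrow> g H \<Longrightarrow> \<bar>p H\<bar> \<ge> 1"
    using N_deg_attained[OF assms(1)] by metis
  let ?G = "\<lambda>X. {i \<in> V'. \<beta> i \<in> X}"
  obtain Q where Q: "degree Q \<le> 2 * N_deg V g"
    and avg: "\<And>j. j \<le> card A \<Longrightarrow> real (card A choose j) * poly Q (real j)
      = (\<Sum>X | X \<subseteq> A \<and> card X = j. (p (?G X))\<^sup>2)"
    using symmetrization_of_square[OF assms(1) p assms(2-4)] by blast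
  have sub: "?G X \<subseteq> V" for X using assms(2) by auto
  have "(\<not> f j \<longrightarrow> 0 \<le> poly Q (real j) \<and> poly Q (real j) \<le> 1/9) \<and> (f j \<longrightarrow> 1 \<le> poly Q (real j))"
    if j: "j \<le> card A" for j
  proof -
    let ?S = "{X. X \<subseteq> A \<and> card X = j}"
    have card: "card ?S = card A choose j" by (rule n_subsets[OF assms(4)])
    have pos: "real (card A choose j) > 0" using j by simp
    have "0 \<le> real (card A choose j) * poly Q (real j)"
      unfolding avg[OF j] by (intro sum_nonneg) auto
    then have nonneg: "0 \<le> poly Q (real j)" using pos by (simp add: zero_le_mult_iff)
    have "poly Q (real j) \<le> 1/9" if "\<not> f j"
    proof -
      have "(p (?G X))\<^sup>2 \<le> 1/9" if "X \<in> ?S" for X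
      proof -
        have "\<bar>p (?G X)\<bar> \<le> 1/3" using small[OF sub] sym[of X] that \<open>\<not> f j\<close> by auto
        then have "\<bar>p (?G X)\<bar>\<^sup>2 \<le> (1/3)\<^sup>2" by (intro power_mono) auto
        then show ?thesis by (simp add: power2_eq_square)
      qed
      then have "real (card A choose j) * poly Q (real j) \<le> real (card ?S) * (1/9)"
        unfolding avg[OF j] by (rule sum_bounded_above)
      then show ?thesis using pos card by simp
    qed
    moreover have "1 \<le> poly Q (real j)" if "f j"
    proof -
      have "1 \<le> (p (?G X))\<^sup>2" if "X \<in> ?S" for X
      proof -
        have "1 \<le> \<bar>p (?G X)\<bar>" using large[OF sub] sym[of X] that \<open>f j\<close> by auto
        then show ?thesis by (metis abs_le_square_iff abs_one one_power2 power2_abs)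
      qed
      then have "real (card ?S) * 1 \<le> real (card A choose j) * poly Q (real j)"
        unfolding avg[OF j] by (rule sum_bounded_below)
      then show ?thesis using pos card by simp
    qed
    ultimately show ?thesis using nonneg by blast
  qed
  then show ?thesis using that[OF Q] unfolding separates_def by blast
qed

section \<open>Interpolation and extrapolation at quadratically spaced nodes\<close>

lemma lagrange_interpolation:
  fixes q :: "'a::field poly"
  assumes "inj_on t {..D}" "degree q \<le> D"
  shows "poly q x = (\<Sum>j\<le>D. poly q (t j) * (\<Prod>i\<in>{..D}-{j}. (x - t i) / (t j - t i)))"
proof -
  define l where "l = (\<lambda>j. \<Prod>i\<in>{..D}-{j}. smult (1 / (t j - t i)) [:- t i, 1:])"
  define L where "L = (\<Sum>j\<le>D. smult (poly q (t j)) (l j))"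
  have deg_l: "degree (l j) \<le> D" if "j \<le> D" for j
  proof -
    have "degree (l j) \<le> (\<Sum>i\<in>{..D}-{j}. degree (smult (1 / (t j - t i)) [:- t i, 1:]))"
      unfolding l_def by (rule order.trans[OF degree_prod_sum_le]) auto
    also have "\<dots> \<le> (\<Sum>i\<in>{..D}-{j}. 1)"
      by (rule sum_mono) (auto intro: order.trans[OF degree_smult_le])
    also have "\<dots> = D" using that by simp
    finally show ?thesis .
  qed
  have poly_l: "poly (l j) y = (\<Prod>i\<in>{..D}-{j}. (y - t i) / (t j - t i))" for j y
    unfolding l_def poly_prod by (intro prod.cong refl) (simp add: diff_divide_distrib)
  have l_node: "poly (l j) (t s) = of_bool (s = j)" if "j \<le> D" "s \<le> D" for j s
  proof (cases "s = j")
    case True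
    have "(t j - t i) / (t j - t i) = 1" if "i \<in> {..D} - {j}" for i
      using that \<open>j \<le> D\<close> assms(1) by (auto simp: inj_on_def)
    then show ?thesis using True unfolding poly_l by (simp add: prod.neutral)
  next
    case False
    then show ?thesis unfolding poly_l using that by (auto intro!: prod_zero)
  qed
  have "poly L (t s) = poly q (t s)" if "s \<le> D" for s
  proof -
    have "poly L (t s) = (\<Sum>j\<le>D. poly q (t j) * of_bool (s = j))"
      unfolding L_def poly_sum poly_smult using that by (intro sum.cong refl) (simp add: l_node)
    also have "\<dots> = poly q (t s)" using that by (simp add: of_bool_def if_distrib cong: if_cong)
    finally show ?thesis .
  qed
  moreover have "degree L \<le> D"
    unfolding L_def by (intro degree_sum_le) (use deg_l in \<open>auto intro: order.trans[OF degree_smult_le]\<close>)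
  moreover have "card (t ` {..D}) = D + 1" using assms(1) by (simp add: card_image)
  ultimately have "q = L"
    using assms(2) by (intro poly_eqI_degree[where A = "t ` {..D}"]) auto
  then have "poly q x = poly L x" by simp
  also have "\<dots> = (\<Sum>j\<le>D. poly q (t j) * (\<Prod>i\<in>{..D}-{j}. (x - t i) / (t j - t i)))"
    unfolding L_def by (simp add: poly_sum poly_l)
  finally show ?thesis .
qed

lemma inverse_square_le_telescoping:
  fixes x :: real
  assumes "1 \<le> x"
  shows "1 / x\<^sup>2 \<le> 2 / x - 2 / (x + 1)"
proof -
  have "x * (x + 1) \<le> 2 * x\<^sup>2"
    using mult_left_mono[of 1 x x] assms by (simp add: power2_eq_square algebra_simps)
  then have "2 / (2 * x\<^sup>2) \<le> 2 / (x * (x + 1))"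
    using assms by (intro divide_left_mono) auto
  also have "\<dots> = 2 / x - 2 / (x + 1)" using assms by (simp add: field_simps)
  finally show ?thesis by simp
qed

text \<open>The term \<open>1 / real (D + 1)\<close> strengthens the bound \<open>2\<close> so that
  the induction closes: each new factor costs at most half of the telescoping majorant.\<close>

lemma prod_one_plus_inverse_squares_le:
  "(\<Prod>i=1..D. 1 + 1 / (4 * (real i)\<^sup>2)) \<le> 2 - 1 / real (D + 1)"
proof (induction D)
  case (Suc D)
  define x where "x = real (D + 1)"
  have x: "x \<ge> 1" by (simp add: x_def)
  have "(\<Prod>i=1..Suc D. 1 + 1 / (4 * (real i)\<^sup>2)) \<le> (2 - 1 / x) * (1 + 1 / (4 * x\<^sup>2))"
    using Suc.IH by (simp add: x_def mult_right_mono)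
  also have "\<dots> \<le> 2 - 1 / (x + 1)"
  proof -
    have "(2 - 1 / x) * (1 + 1 / (4 * x\<^sup>2)) = 2 - 1 / x + (2 - 1 / x) * (1 / (4 * x\<^sup>2))"
      by (simp add: algebra_simps)
    also have "\<dots> \<le> 2 - 1 / x + 2 * (1 / (4 * x\<^sup>2))"
      using x by (intro add_left_mono mult_right_mono) auto
    also have "\<dots> \<le> 2 - 1 / (x + 1)"
      using inverse_square_le_telescoping[OF x] by simp
    finally show ?thesis .
  qed
  finally show ?case by (simp add: x_def add.commute)
qed simp

lemma sum_inverse_squares_le:
  "(\<Sum>i=1..D. 1 / (real i)\<^sup>2) \<le> 2 - 2 / real (D + 1)"
proof (induction D)
  case (Suc D)
  define x where "x = real (D + 1)"
  have x: "x \<ge> 1" by (simp add: x_def)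
  have "(\<Sum>i=1..Suc D. 1 / (real i)\<^sup>2) \<le> 2 - 2 / x + 1 / x\<^sup>2"
    using Suc.IH by (simp add: x_def)
  also have "\<dots> \<le> 2 - 2 / (x + 1)"
    using inverse_square_le_telescoping[OF x] by simp
  finally show ?case by (simp add: x_def add.commute)
qed simp

lemma prod_add_atLeastAtMost:
  "(\<Prod>i=1..a. real j + real i) * fact j = fact (j + a)"
proof (induction a)
  case (Suc a)
  have "(\<Prod>i=1..Suc a. real j + real i) * fact j
      = (real j + real (Suc a)) * ((\<Prod>i=1..a. real j + real i) * fact j)"
    by simp
  also have "\<dots> = fact (j + Suc a)" unfolding Suc.IH by (simp add: algebra_simps)
  finally show ?case .
qed simp

lemma prod_diff_atLeastAtMost:
  assumes "a < j"
  shows "(\<Prod>i=1..a. real j - real i) * fact (j - 1 - a) = fact (j - 1)"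
  using assms
proof (induction a)
  case (Suc a)
  then have "j - 1 - a = Suc (j - 1 - Suc a)" by simp
  then have "fact (j - 1 - a) = (real j - real (Suc a)) * (fact (j - 1 - Suc a) :: real)"
    using Suc.prems by (simp add: of_nat_diff)
  then show ?case using Suc by (simp add: mult.assoc)
qed simp

text \<open>Splitting \<open>i^2 - j^2\<close> into \<open>(i - j) * (i + j)\<close> turns the
  product into factorials. The induction starts at \<open>D = j\<close>, where all remaining
  \<open>i\<close> are below \<open>j\<close>; each later factor has \<open>i > j\<close>, so no
  absolute value changes sign on the way.\<close>

lemma prod_square_nodes_eq:
  assumes "1 \<le> j" "j \<le> D"
  shows "(\<Prod>i\<in>{1..D}-{j}. (real i)\<^sup>2 / \<bar>(real i)\<^sup>2 - (real j)\<^sup>2\<bar>) * (fact (D - j) * fact (D + j))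
    = 2 * (fact D)\<^sup>2"
  using assms(2)
proof (induction D rule: dec_induct)
  case base
  have eq: "{1..j} - {j} = {1..j - 1}" using assms(1) by auto
  let ?A = "\<Prod>i=1..j - 1. real j + real i" and ?B = "\<Prod>i=1..j - 1. real j - real i"
  have "(\<Prod>i\<in>{1..j}-{j}. (real i)\<^sup>2 / \<bar>(real i)\<^sup>2 - (real j)\<^sup>2\<bar>)
      = (\<Prod>i=1..j - 1. real i * real i / ((real j + real i) * (real j - real i)))"
    unfolding eq
  proof (rule prod.cong[OF refl])
    fix i assume "i \<in> {1..j - 1}"
    then have "real i < real j" by auto
    then have "\<bar>(real i)\<^sup>2 - (real j)\<^sup>2\<bar> = (real j)\<^sup>2 - (real i)\<^sup>2" by (simp add: power_strict_mono)
    then show "(real i)\<^sup>2 / \<bar>(real i)\<^sup>2 - (real j)\<^sup>2\<bar> = real i * real i / ((real j + real i) * (real j - real i))"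
      by (simp add: power2_eq_square algebra_simps)
  qed
  also have "\<dots> = fact (j - 1) * fact (j - 1) / (?A * ?B)"
    by (simp add: prod_dividef prod.distrib fact_prod)
  also have "?B = fact (j - 1)" using prod_diff_atLeastAtMost[of "j - 1" j] assms(1) by simp
  also have "?A = fact (j + (j - 1)) / fact j"
    using prod_add_atLeastAtMost[of j "j - 1"] by (simp add: field_simps)
  finally have *: "(\<Prod>i\<in>{1..j}-{j}. (real i)\<^sup>2 / \<bar>(real i)\<^sup>2 - (real j)\<^sup>2\<bar>)
      = fact (j - 1) * fact j / fact (2 * j - 1)"
    using assms(1) by (simp add: mult_2)
  have "(fact (2 * j) :: real) = 2 * real j * fact (2 * j - 1)"
    using assms(1) by (subst fact_reduce) auto
  moreover have "(fact j :: real) = real j * fact (j - 1)"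
    using assms(1) by (subst fact_reduce) auto
  ultimately show ?case
    unfolding * by (simp add: power2_eq_square mult_2[symmetric])
next
  case (step D)
  have eq: "{1..Suc D} - {j} = insert (Suc D) ({1..D} - {j})" using step.hyps by auto
  let ?R = "\<lambda>D. \<Prod>i\<in>{1..D}-{j}. (real i)\<^sup>2 / \<bar>(real i)\<^sup>2 - (real j)\<^sup>2\<bar>"
  let ?x = "real (Suc D)"
  have lt: "real j < ?x" using step.hyps by simp
  then have "\<bar>?x\<^sup>2 - (real j)\<^sup>2\<bar> = (?x - real j) * (?x + real j)"
    using power_strict_mono[OF lt, of 2] by (simp add: power2_eq_square algebra_simps)
  then have R: "?R (Suc D) = ?x\<^sup>2 / ((?x - real j) * (?x + real j)) * ?R D"
    unfolding eq by simp
  have f1: "fact (Suc D - j) = (?x - real j) * (fact (D - j) :: real)"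
    using step.hyps by (simp add: Suc_diff_le of_nat_diff)
  have f2: "fact (Suc D + j) = (?x + real j) * (fact (D + j) :: real)" by simp
  have "?R (Suc D) * (fact (Suc D - j) * fact (Suc D + j))
      = ?x\<^sup>2 * (?R D * (fact (D - j) * fact (D + j)))"
    unfolding R f1 f2
  proof -
    have cancel: "y / (a * b) * r * (a * F * (b * G)) = y * (r * (F * G))"
      if "a \<noteq> 0" "b \<noteq> 0" for y a b r F G :: real
      using that by (simp add: field_simps)
    show "?x\<^sup>2 / ((?x - real j) * (?x + real j)) * ?R D
        * ((?x - real j) * fact (D - j) * ((?x + real j) * fact (D + j)))
      = ?x\<^sup>2 * (?R D * (fact (D - j) * fact (D + j)))"
      using lt by (intro cancel) auto
  qed
  also have "\<dots> = 2 * (fact (Suc D))\<^sup>2"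
    unfolding step.IH by (simp add: power2_eq_square)
  finally show ?case .
qed

text \<open>By the closed form, the product is twice the quotient of
  \<open>2 * D choose (D + j)\<close> by the central coefficient \<open>2 * D choose D\<close>,
  which is the largest.\<close>

lemma prod_square_nodes_le:
  assumes "1 \<le> j" "j \<le> D"
  shows "(\<Prod>i\<in>{1..D}-{j}. (real i)\<^sup>2 / \<bar>(real i)\<^sup>2 - (real j)\<^sup>2\<bar>) \<le> 2"
proof -
  have "real (2 * D choose (D + j)) \<le> real (2 * D choose D)"
    using binomial_maximum'[of D "D + j"] by simp
  moreover have "real (2 * D choose (D + j)) = fact (2 * D) / (fact (D + j) * fact (D - j))"
    using assms by (subst binomial_fact) (auto simp: mult_2)
  moreover have "real (2 * D choose D) = fact (2 * D) / (fact D)\<^sup>2"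
    by (subst binomial_fact) (auto simp: mult_2 power2_eq_square)
  ultimately have "fact (2 * D) / (fact (D + j) * fact (D - j)) \<le> fact (2 * D) / (fact D :: real)\<^sup>2"
    by simp
  then have "(fact D :: real)\<^sup>2 \<le> fact (D - j) * fact (D + j)"
    by (simp add: divide_le_cancel frac_le_eq field_simps)
  then have "(\<Prod>i\<in>{1..D}-{j}. (real i)\<^sup>2 / \<bar>(real i)\<^sup>2 - (real j)\<^sup>2\<bar>) * (fact (D - j) * fact (D + j))
      \<le> 2 * (fact (D - j) * fact (D + j))"
    unfolding prod_square_nodes_eq[OF assms] by simp
  then show ?thesis by (rule mult_right_le_imp_le) simp
qed

text \<open>Interpolation at the quadratically spaced nodes \<open>1 + 4j\<^sup>2\<close>, as for Chebyshev nodes, has a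
  bounded Lebesgue function at the point \<open>0\<close>.\<close>
lemma extrapolate_from_square_nodes:
  fixes q :: "real poly"
  assumes "degree q \<le> D" "\<And>j. j \<le> D \<Longrightarrow> \<bar>poly q (1 + 4 * (real j)\<^sup>2)\<bar> \<le> 1/9"
  shows "\<bar>poly q 0\<bar> < 1"
proof -
  define t where "t = (\<lambda>j::nat. 1 + 4 * (real j)\<^sup>2)"
  define l where "l = (\<lambda>j. \<Prod>i\<in>{..D}-{j}. (0 - t i) / (t j - t i))"
  \<comment> \<open>For \<open>i > 0\<close> one has \<open>t i = 4 * i^2 * r i\<close>. The factors
    of \<open>l j\<close> thus split into the \<open>r i\<close>, whose product is at most
    \<open>2\<close>, and the factors for nodes at exact squares.\<close>
  define r where "r = (\<lambda>i::nat. 1 + 1 / (4 * (real i)\<^sup>2))"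
  have inj: "inj_on t {..D}" by (auto simp: inj_on_def t_def)
  have abs_l: "\<bar>l j\<bar> = (\<Prod>i\<in>{..D}-{j}. t i / (4 * \<bar>(real i)\<^sup>2 - (real j)\<^sup>2\<bar>))" for j
  proof -
    have "\<bar>t j - t i\<bar> = 4 * \<bar>(real i)\<^sup>2 - (real j)\<^sup>2\<bar>" for i by (simp add: t_def abs_if)
    moreover have "\<bar>t i\<bar> = t i" for i by (simp add: t_def)
    ultimately show ?thesis by (simp add: l_def abs_prod abs_divide)
  qed
  have r_prod: "prod r {1..D} \<le> 2"
    using prod_one_plus_inverse_squares_le[of D] by (simp add: r_def add_increasing2 order.trans)
  have l0: "\<bar>l 0\<bar> \<le> 2"
  proof -
    have "{..D} - {0} = {1..D}" by auto
    then have "\<bar>l 0\<bar> = prod r {1..D}"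
      unfolding abs_l by (intro prod.cong) (auto simp: r_def t_def field_simps)
    then show ?thesis using r_prod by simp
  qed
  have lj: "\<bar>l j\<bar> \<le> 1 / (real j)\<^sup>2" if j: "1 \<le> j" "j \<le> D" for j
  proof -
    let ?S = "{1..D} - {j}"
    let ?w = "\<lambda>i. (real i)\<^sup>2 / \<bar>(real i)\<^sup>2 - (real j)\<^sup>2\<bar>"
    \<comment> \<open>The node \<open>t 0 = 1\<close> supplies the decay
      \<open>1 / (4 * j^2)\<close> that makes the sum over \<open>j\<close> bounded.\<close>
    have "{..D} - {j} = insert 0 ?S" using j by auto
    then have "\<bar>l j\<bar> = 1 / (4 * (real j)\<^sup>2) * (\<Prod>i\<in>?S. t i / (4 * \<bar>(real i)\<^sup>2 - (real j)\<^sup>2\<bar>))"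
      unfolding abs_l by (simp add: t_def)
    also have "(\<Prod>i\<in>?S. t i / (4 * \<bar>(real i)\<^sup>2 - (real j)\<^sup>2\<bar>)) = (\<Prod>i\<in>?S. r i * ?w i)"
      by (intro prod.cong) (auto simp: r_def t_def field_simps)
    also have "\<dots> = prod r ?S * prod ?w ?S" by (rule prod.distrib)
    also have "\<dots> \<le> 2 * 2"
    proof (intro mult_mono)
      have "prod r ?S \<le> prod r {1..D}" by (intro prod_mono2) (auto simp: r_def)
      then show "prod r ?S \<le> 2" using r_prod by simp
      show "prod ?w ?S \<le> 2" by (rule prod_square_nodes_le[OF j])
      show "0 \<le> prod ?w ?S" by (intro prod_nonneg) auto
    qed simp
    finally show ?thesis by (simp add: mult_left_mono divide_right_mono)
  qed
  have "\<bar>poly q 0\<bar> = \<bar>\<Sum>j\<le>D. poly q (t j) * l j\<bar>"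
    unfolding l_def using lagrange_interpolation[OF inj assms(1), of 0] by simp
  also have "\<dots> \<le> (\<Sum>j\<le>D. \<bar>poly q (t j) * l j\<bar>)" by (rule sum_abs)
  also have "\<dots> \<le> (\<Sum>j\<le>D. 1/9 * \<bar>l j\<bar>)"
    unfolding abs_mult using assms(2) by (intro sum_mono mult_right_mono) (auto simp: t_def)
  also have "\<dots> = 1/9 * (\<bar>l 0\<bar> + (\<Sum>j=1..D. \<bar>l j\<bar>))"
    unfolding sum_distrib_left[symmetric] by (simp add: atMost_atLeast0 sum.atLeast_Suc_atMost)
  also have "\<dots> \<le> 1/9 * (2 + (\<Sum>j=1..D. 1 / (real j)\<^sup>2))"
    by (intro mult_left_mono add_mono l0 sum_mono lj) auto
  \<comment> \<open>The total is at most \<open>1/9 * (2 + 2)\<close>.\<close>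
  also have "\<dots> < 1"
  proof -
    have "(\<Sum>j=1..D. 1 / (real j)\<^sup>2) \<le> 2"
      by (rule order.trans[OF sum_inverse_squares_le]) simp
    then show ?thesis by simp
  qed
  finally show ?thesis .
qed

section \<open>Bounds forced on separating polynomials of low degree\<close>

text \<open>Moves the extrapolation from \<open>0\<close> to \<open>x\<close> by an affine
  substitution; the sign \<epsilon> says on which side of \<open>x\<close> the run of small values
  lies.\<close>

lemma no_jump_after_run:
  fixes Q :: "real poly"
  assumes "degree Q \<le> D" "\<epsilon> = 1 \<or> \<epsilon> = -1"
    and "\<And>j. j \<le> D \<Longrightarrow> \<bar>poly Q (x + \<epsilon> * (1 + 4 * (real j)\<^sup>2))\<bar> \<le> 1/9"
  shows "\<bar>poly Q x\<bar> < 1"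
proof -
  define q where "q = pcompose Q [:x, \<epsilon>:]"
  have "degree q \<le> D" unfolding q_def using assms(1,2) by (auto simp: degree_pcompose)
  then have "\<bar>poly q 0\<bar> < 1"
    using assms(3) by (intro extrapolate_from_square_nodes) (auto simp: q_def poly_pcompose mult.commute)
  then show ?thesis by (simp add: q_def poly_pcompose)
qed

text \<open>For larger \<open>h\<close> all nodes \<open>h - (1 + 4 * j^2)\<close> would be counts
  below \<open>h\<close>, where \<open>Q\<close> is small, and \<open>Q\<close> could not reach
  \<open>1\<close> at \<open>h\<close>.\<close>

lemma separates_and_bound:
  assumes "degree Q \<le> D" "separates h (\<lambda>j. j = h) Q"
  shows "h \<le> 4 * D\<^sup>2"
proof (rule ccontr)
  assume "\<not> ?thesis"
  then have h: "4 * D\<^sup>2 + 1 \<le> h" by simp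
  have "\<bar>poly Q (real h + - 1 * (1 + 4 * (real j)\<^sup>2))\<bar> \<le> 1/9" if "j \<le> D" for j
  proof -
    have "j\<^sup>2 \<le> D\<^sup>2" using that by (simp add: power_mono)
    then have le: "1 + 4 * j\<^sup>2 \<le> h" using h by linarith
    then have "real h + - 1 * (1 + 4 * (real j)\<^sup>2) = real (h - (1 + 4 * j\<^sup>2))"
      by (simp add: of_nat_diff)
    moreover have "h - (1 + 4 * j\<^sup>2) \<le> h" "h - (1 + 4 * j\<^sup>2) \<noteq> h" using le by auto
    ultimately show ?thesis using assms(2) unfolding separates_def by (metis abs_of_nonneg)
  qed
  then have "\<bar>poly Q (real h)\<bar> < 1" using no_jump_after_run[OF assms(1), of "-1"] by blast
  moreover have "1 \<le> poly Q (real h)" using assms(2) unfolding separates_def by blast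
  ultimately show False by simp
qed

lemma separates_nonconstant_bound:
  assumes Q: "degree Q \<le> D" "separates m f Q"
    and Q': "degree Q' \<le> D" "separates m (\<lambda>j. \<not> f j) Q'"
    and nonconst: "i \<le> m" "i' \<le> m" "f i \<noteq> f i'"
  shows "m < (D + 1) * (4 * D\<^sup>2 + 1)"
proof (rule ccontr)
  \<comment> \<open>This is the distance from the point of extrapolation to the farthest node. Below
    \<open>m\<close> there is room for \<open>D + 1\<close> blocks of this length.\<close>
  define L where "L = 4 * D\<^sup>2 + 1"
  assume "\<not> ?thesis"
  then have m: "(D + 1) * L \<le> m" by (simp add: L_def)
  have block: "s * L + L \<le> m" if "s \<le> D" for s
  proof -
    have "s * L + L = (s + 1) * L" by simp
    also have "\<dots> \<le> (D + 1) * L" using that by (intro mult_right_mono) auto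
    finally show ?thesis using m by (rule order.trans)
  qed
  have "\<exists>s\<le>D. \<forall>x\<in>{s * L..<s * L + L}. f x = f (s * L)"
  proof (rule ccontr)
    assume neg: "\<not> ?thesis"
    \<comment> \<open>If \<open>f\<close> varied on every block, \<open>Q\<close> would cross
      \<open>1/2\<close> inside each one. The blocks are disjoint, so \<open>q\<close> would have
      \<open>D + 1\<close> distinct roots.\<close>
    define q where "q = Q - [:1/2:]"
    have "\<exists>y. real (s * L) < y \<and> y < real (s * L + L) \<and> poly q y = 0 \<and> q \<noteq> 0" if sD: "s \<le> D" for s
    proof -
      obtain x where x: "s * L \<le> x" "x < s * L + L" "f x \<noteq> f (s * L)"
        using neg sD by (metis atLeastLessThan_iff)
      then have lt: "s * L < x" using nat_less_le by blast
      have "x \<le> m" "s * L \<le> m" using x block[OF sD] by auto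
      then have "poly Q (real x) \<le> 1/9 \<and> 1 \<le> poly Q (real (s * L))
          \<or> 1 \<le> poly Q (real x) \<and> poly Q (real (s * L)) \<le> 1/9"
        using Q(2) x(3) unfolding separates_def by blast
      then have "poly q (real (s * L)) * poly q (real x) < 0"
        by (auto simp: q_def intro: mult_neg_pos mult_pos_neg)
      moreover have "real (s * L) < real x" using lt by (simp only: of_nat_less_iff)
      ultimately obtain y where "real (s * L) < y" "y < real x" "poly q y = 0"
        using poly_IVT by blast
      moreover have "q \<noteq> 0" using \<open>poly q (real (s * L)) * poly q (real x) < 0\<close> by auto
      moreover have "real x < real (s * L + L)" using x(2) by (simp only: of_nat_less_iff)
      ultimately show ?thesis by (intro exI[of _ y]) auto
    qed
    then obtain y where y: "\<And>s. s \<le> D \<Longrightarrow> real (s * L) < y s \<and> y s < real (s * L + L) \<and> poly q (y s) = 0"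
      and "q \<noteq> 0"
      by (metis zero_le)
    have mono: "y s < y s'" if "s < s'" "s' \<le> D" for s s'
    proof -
      have "s * L + L = (s + 1) * L" by simp
      also have "\<dots> \<le> s' * L" using that by (intro mult_right_mono) auto
      finally have "real (s * L + L) \<le> real (s' * L)" by (rule of_nat_mono)
      then show ?thesis using y[of s] y[of s'] that by linarith
    qed
    have "inj_on y {..D}"
      using mono by (auto simp: inj_on_def) (metis linorder_neqE_nat order_less_irrefl)
    then have "D + 1 = card (y ` {..D})" by (simp add: card_image)
    also have "\<dots> \<le> card {x. poly q x = 0}"
      using y \<open>q \<noteq> 0\<close> by (intro card_mono poly_roots_finite) auto
    also have "\<dots> \<le> degree q" by (rule card_poly_roots_bound[OF \<open>q \<noteq> 0\<close>])
    also have "\<dots> \<le> D" unfolding q_def using Q(1) by (intro degree_diff_le) auto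
    finally show False by simp
  qed
  then obtain s where s: "s \<le> D" and *: "\<forall>x\<in>{s * L..<s * L + L}. f x = f (s * L)"
    by blast
  have const: "f x = f (s * L)" if "s * L \<le> x" "x < s * L + L" for x
    by (rule bspec[OF *]) (use that in simp)
  define v where "v = f (s * L)"
  \<comment> \<open>\<open>R\<close> is chosen to be small on the constant block: it is
    \<open>Q\<close> if \<open>v\<close> is false and \<open>Q'\<close> if \<open>v\<close> is
    true.\<close>
  obtain R where R: "degree R \<le> D" "separates m (\<lambda>j. f j \<noteq> v) R"
    using Q Q' by (cases v) auto
  have big: "1 \<le> poly R (real x)" if "x \<le> m" "f x \<noteq> v" for x
    using R(2) that unfolding separates_def by blast
  have small: "\<bar>poly R (real x)\<bar> \<le> 1/9" if "x \<le> m" "f x = v" for x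
    using R(2) that unfolding separates_def by (metis abs_of_nonneg)
  have node: "1 + 4 * j\<^sup>2 \<le> L" if "j \<le> D" for j
    using power_mono[OF that, of 2] by (simp add: L_def)
  obtain z where z: "z \<le> m" "f z \<noteq> v" using nonconst by metis
  have "z < s * L \<or> s * L + L \<le> z" using z const[of z] v_def by force
  then show False
  proof
    assume zs: "z < s * L"
    \<comment> \<open>The last exceptional count before the block: everything from
      \<open>w + 1\<close> to the end of the block has value \<open>v\<close>, so all nodes to the
      right of \<open>w\<close> lie in this run.\<close>
    define w where "w = Max {x. x < s * L \<and> f x \<noteq> v}"
    have fin: "finite {x. x < s * L \<and> f x \<noteq> v}" by simp
    have "w \<in> {x. x < s * L \<and> f x \<noteq> v}" unfolding w_def using zs z by (intro Max_in fin) auto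
    then have w: "w < s * L" "f w \<noteq> v" by auto
    have run: "f x = v" if "w < x" "x < s * L + L" for x
    proof (cases "x < s * L")
      case True
      then show ?thesis using Max_ge[OF fin, of x] that unfolding w_def[symmetric] by force
    next
      case False
      then show ?thesis unfolding v_def using that by (intro const) auto
    qed
    have "\<bar>poly R (real w + 1 * (1 + 4 * (real j)\<^sup>2))\<bar> \<le> 1/9" if "j \<le> D" for j
    proof -
      have "w + (1 + 4 * j\<^sup>2) < s * L + L" using w node[OF that] by linarith
      then have "\<bar>poly R (real (w + (1 + 4 * j\<^sup>2)))\<bar> \<le> 1/9"
        using block[OF s] by (intro small run) auto
      then show ?thesis by (simp add: ac_simps)
    qed
    then have "\<bar>poly R (real w)\<bar> < 1" using no_jump_after_run[OF R(1), of 1] by blast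
    moreover have "1 \<le> poly R (real w)" using w block[OF s] by (intro big) auto
    ultimately show False by simp
  next
    assume zs: "s * L + L \<le> z"
    \<comment> \<open>Mirror case: the first exceptional count after the block, with the nodes to
      its left.\<close>
    define w where "w = (LEAST x. s * L \<le> x \<and> f x \<noteq> v)"
    have "s * L \<le> z \<and> f z \<noteq> v" using zs z by simp
    then have "s * L \<le> w \<and> f w \<noteq> v" and "w \<le> z"
      unfolding w_def by (rule LeastI, rule Least_le)
    then have w: "s * L \<le> w" "f w \<noteq> v" "w \<le> z" by auto
    have run: "f x = v" if "s * L \<le> x" "x < w" for x
      using not_less_Least[of x "\<lambda>x. s * L \<le> x \<and> f x \<noteq> v"] that by (auto simp: w_def)
    have wL: "s * L + L \<le> w" using w const[of w] v_def by force
    have "\<bar>poly R (real w + - 1 * (1 + 4 * (real j)\<^sup>2))\<bar> \<le> 1/9" if "j \<le> D" for j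
    proof -
      have le: "s * L + (1 + 4 * j\<^sup>2) \<le> w" using wL node[OF that] by linarith
      then have "\<bar>poly R (real (w - (1 + 4 * j\<^sup>2)))\<bar> \<le> 1/9"
        using w z by (intro small run) auto
      moreover have "real w + - 1 * (1 + 4 * (real j)\<^sup>2) = real (w - (1 + 4 * j\<^sup>2))"
        using le by (simp add: of_nat_diff)
      ultimately show ?thesis by simp
    qed
    then have "\<bar>poly R (real w)\<bar> < 1" using no_jump_after_run[OF R(1), of "-1"] by blast
    moreover have "1 \<le> poly R (real w)" using w z by (intro big) auto
    ultimately show False by simp
  qed
qed

section \<open>Relabelling vertices and packing disjoint copies\<close>

lemma extend_inj_on_to_permutation:
  assumes "finite A" "S \<subseteq> A" "inj_on s S" "s ` S \<subseteq> A"
  obtains \<sigma> where "bij_betw \<sigma> A A" "\<And>x. x \<in> S \<Longrightarrow> \<sigma> x = s x"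
proof -
  have "finite S" using assms finite_subset by blast
  then have "card (A - S) = card (A - s ` S)"
    using assms by (simp add: card_Diff_subset card_image)
  then obtain h where h: "bij_betw h (A - S) (A - s ` S)"
    using assms(1) finite_same_card_bij by (metis finite_Diff)
  define \<sigma> where "\<sigma> = (\<lambda>x. if x \<in> S then s x else h x)"
  have "bij_betw \<sigma> S (s ` S)"
    using assms(3) by (subst bij_betw_cong[where g = s]) (auto simp: \<sigma>_def bij_betw_def)
  moreover have "bij_betw \<sigma> (A - S) (A - s ` S)"
    using h by (subst bij_betw_cong[where g = h]) (auto simp: \<sigma>_def)
  ultimately have "bij_betw \<sigma> (S \<union> (A - S)) (s ` S \<union> (A - s ` S))"
    by (rule bij_betw_combine) auto
  moreover have "S \<union> (A - S) = A" "s ` S \<union> (A - s ` S) = A" using assms by auto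
  ultimately have "bij_betw \<sigma> A A" by simp
  then show ?thesis using that by (simp add: \<sigma>_def)
qed

text \<open>Only vertices lying in edges affect the image, so an injection on them may be replaced
  by a permutation of \<open>{1..n}\<close> extending it.\<close>

lemma hypergraph_property_inj_image:
  assumes "hypergraph_property n k P" "H \<subseteq> ksets n k" "inj_on s (\<Union>H)" "s ` \<Union>H \<subseteq> {1..n}"
  shows "P ((`) s ` H) = P H"
proof -
  have "\<Union>H \<subseteq> {1..n}" using assms(2) by (auto simp: ksets_def)
  then obtain \<sigma> where \<sigma>: "bij_betw \<sigma> {1..n} {1..n}" "\<And>x. x \<in> \<Union>H \<Longrightarrow> \<sigma> x = s x"
    using extend_inj_on_to_permutation[of "{1..n}" "\<Union>H" s] assms(3,4) by auto
  have "(`) s ` H = (\<lambda>S. \<sigma> ` S) ` H"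
    by (intro image_cong refl) (metis \<sigma>(2) UnionI)
  then show ?thesis using assms(1,2) \<sigma>(1) unfolding hypergraph_property_def by metis
qed

lemma finite_ksets: "finite (ksets n k)"
  unfolding ksets_def by (rule finite_subset[of _ "Pow {1..n}"]) auto

lemma hypergraph_property_order_bound:
  assumes "k \<ge> 1" and inv: "hypergraph_property n k P"
    and H: "H \<subseteq> ksets n k" "P H" and minimal: "\<And>H'. H' \<subset> H \<Longrightarrow> \<not> P H'" and "\<not> P {}"
    and D: "D = 2 * M_deg n k P"
  shows "n \<le> (D + 1) * (4 * D\<^sup>2 + 1) * (k * (4 * D\<^sup>2))"
proof -
  define V where "V = ksets n k"
  have finV: "finite V" unfolding V_def by (rule finite_ksets)
  have finH: "finite H" using H finV finite_subset V_def by blast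
  have edge: "S \<subseteq> {1..n}" "card S = k" "finite S" "S \<noteq> {}" if "S \<in> H" for S
  proof -
    show "S \<subseteq> {1..n}" "card S = k" using that H(1) by (auto simp: ksets_def)
    then show "finite S" "S \<noteq> {}" using assms(1) finite_subset[of S "{1..n}"] by auto
  qed
  define W where "W = \<Union>H"
  define w where "w = card W"
  have W: "W \<subseteq> {1..n}" "finite W" using edge finH by (auto simp: W_def)
  have "H \<noteq> {}" using H assms by auto
  then have "W \<noteq> {}" using edge by (auto simp: W_def)
  then have "w > 0" using W by (simp add: w_def card_gt_0_iff)
  have "w \<le> n" using card_mono[OF _ W(1)] by (simp add: w_def)
  have degs: "2 * N_deg V P \<le> D" "2 * N_deg V (\<lambda>H. \<not> P H) \<le> D"
    unfolding D M_deg_def V_def by auto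

  have "w \<le> (\<Sum>S\<in>H. card S)"
    unfolding w_def W_def by (rule card_Union_le_sum_card)
  also have "\<dots> = k * card H" using edge by simp
  also have "card H \<le> 4 * D\<^sup>2"
  proof -
    \<comment> \<open>Minimality makes \<open>P\<close> the conjunction of all edges of
      \<open>H\<close>; taking \<open>id\<close> for the fibre map keeps every edge a separate
      variable.\<close>
    have "P {S \<in> H. id S \<in> X} = (card X = card H)" if "X \<subseteq> H" for X
    proof -
      have "{S \<in> H. id S \<in> X} = X" using that by auto
      moreover have "X = H \<longleftrightarrow> card X = card H" using that finH card_subset_eq by auto
      ultimately show ?thesis using that minimal[of X] H(2) by (metis psubsetI)
    qed
    then obtain Q where "degree Q \<le> 2 * N_deg V P" "separates (card H) (\<lambda>j. j = card H) Q"
      using symmetric_restriction_separates[OF finV, of H id H P "\<lambda>j. j = card H"] H(1) finH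
      by (auto simp: V_def)
    then show ?thesis using degs(1) by (intro separates_and_bound[of Q]) auto
  qed
  finally have w_le: "w \<le> k * (4 * D\<^sup>2)" by simp

  obtain e where e: "bij_betw e W {0..<w}" using ex_bij_betw_finite_nat[OF W(2)] by (auto simp: w_def)
  have e_lt: "e v < w" if "v \<in> W" for v using bij_betwE[OF e] that by auto
  have e_inj: "inj_on e W" using e by (rule bij_betw_imp_inj_on)
  define m where "m = n div w"
  \<comment> \<open>Copy \<open>i\<close> occupies the interval from \<open>1 + i * w\<close> to
    \<open>(i + 1) * w\<close>; the shift by \<open>1\<close> is there because vertices start at
    \<open>1\<close>. \<open>idx\<close> recovers the copy from a vertex.\<close>
  define \<phi> where "\<phi> = (\<lambda>i v. 1 + i * w + e v)"
  define idx where "idx = (\<lambda>x. (x - 1) div w)"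
  define copies where "copies = (\<lambda>X. \<Union>i\<in>X. (`) (\<phi> i) ` H)"
  have idx_\<phi>: "idx (\<phi> i v) = i" if "v \<in> W" for i v
    using e_lt[OF that] by (simp add: idx_def \<phi>_def)
  have mod_\<phi>: "(\<phi> i v - 1) mod w = e v" if "v \<in> W" for i v
    using e_lt[OF that] by (simp add: \<phi>_def)
  have \<phi>_range: "\<phi> i v \<in> {1..n}" if "i < m" "v \<in> W" for i v
  proof -
    have "i * w + w = (i + 1) * w" by simp
    also have "\<dots> \<le> m * w" using that by (intro mult_right_mono) auto
    also have "\<dots> \<le> n" by (simp add: m_def)
    finally show ?thesis using e_lt[OF that(2)] by (simp add: \<phi>_def)
  qed
  have \<phi>_inj: "inj_on (\<phi> i) W" for i
    using e_inj by (auto simp: inj_on_def \<phi>_def)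
  have sub_W: "S \<subseteq> W" if "S \<in> H" for S using that by (auto simp: W_def)
  have copies_V: "copies X \<subseteq> V" if "X \<subseteq> {..<m}" for X
  proof
    fix T assume "T \<in> copies X"
    then obtain i S where iS: "i \<in> X" "S \<in> H" "T = \<phi> i ` S" by (auto simp: copies_def)
    then have "T \<subseteq> {1..n}" using \<phi>_range sub_W that by blast
    moreover have "card T = k"
      using iS edge sub_W \<phi>_inj by (metis card_image inj_on_subset)
    ultimately show "T \<in> V" by (simp add: V_def ksets_def)
  qed
  have idx_Min: "idx (Min (\<phi> i ` S)) = i" if "S \<in> H" for i S
  proof -
    have "Min (\<phi> i ` S) \<in> \<phi> i ` S" using edge[OF that] by (intro Min_in) auto
    then show ?thesis using idx_\<phi> sub_W[OF that] by auto
  qed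
  \<comment> \<open>An edge is assigned to its copy through its least vertex; edges are nonempty
    since \<open>k \<ge> 1\<close>. Identifying the variables of each copy leaves one variable per
    copy.\<close>
  have restrict: "{T \<in> copies {..<m}. idx (Min T) \<in> X} = copies X" if "X \<subseteq> {..<m}" for X
    using that idx_Min by (auto simp: copies_def)
  have symmetric: "P (copies X) = P (copies {..<card X})" if X: "X \<subseteq> {..<m}" for X
  proof -
    have finX: "finite X" using X finite_subset by blast
    then obtain \<pi> where \<pi>: "bij_betw \<pi> X {0..<card X}" using ex_bij_betw_finite_nat by blast
    have "card X \<le> m" using card_mono[OF _ X] by simp
    then have \<pi>_lt: "\<pi> i < m" if "i \<in> X" for i using bij_betwE[OF \<pi>] that by fastforce
    \<comment> \<open>Moves copy \<open>i\<close> onto copy \<open>\<pi> i\<close> and keeps the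
      position inside the copy.\<close>
    define s where "s = (\<lambda>x. 1 + \<pi> (idx x) * w + (x - 1) mod w)"
    have s_\<phi>: "s (\<phi> i v) = \<phi> (\<pi> i) v" if "v \<in> W" for i v
      using idx_\<phi>[OF that] mod_\<phi>[OF that] by (simp add: s_def \<phi>_def)
    have s_image: "s ` \<phi> i ` S = \<phi> (\<pi> i) ` S" if "S \<in> H" for i S
      unfolding image_image using sub_W[OF that] s_\<phi> by (intro image_cong) auto
    have vertex: "\<exists>i\<in>X. \<exists>v\<in>W. x = \<phi> i v" if "x \<in> \<Union>(copies X)" for x
      using that by (auto simp: copies_def W_def)
    have "inj_on s (\<Union>(copies X))"
    proof (rule inj_onI)
      fix x y assume "x \<in> \<Union>(copies X)" "y \<in> \<Union>(copies X)" and eq: "s x = s y"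
      then obtain i v i' v' where *: "i \<in> X" "v \<in> W" "x = \<phi> i v" "i' \<in> X" "v' \<in> W" "y = \<phi> i' v'"
        using vertex by metis
      then have "\<phi> (\<pi> i) v = \<phi> (\<pi> i') v'" using eq s_\<phi> by simp
      then have "\<pi> i = \<pi> i'" "e v = e v'" using idx_\<phi> mod_\<phi> * by metis+
      then show "x = y"
        using * \<pi> e_inj by (metis bij_betw_imp_inj_on inj_on_eq_iff)
    qed
    moreover have "s ` \<Union>(copies X) \<subseteq> {1..n}"
    proof (rule image_subsetI)
      fix x assume "x \<in> \<Union>(copies X)"
      then obtain i v where "i \<in> X" "v \<in> W" "x = \<phi> i v" using vertex by blast
      then show "s x \<in> {1..n}" using s_\<phi> \<phi>_range \<pi>_lt by metis
    qed
    ultimately have "P ((`) s ` copies X) = P (copies X)"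
      using hypergraph_property_inj_image[OF inv] copies_V[OF X] by (simp add: V_def)
    moreover have "(`) s ` copies X = copies (\<pi> ` X)"
    proof -
      have "(`) s ` copies X = (\<Union>i\<in>X. (\<lambda>S. s ` \<phi> i ` S) ` H)"
        by (simp add: copies_def image_UN image_image)
      also have "\<dots> = (\<Union>i\<in>X. (`) (\<phi> (\<pi> i)) ` H)"
        by (intro SUP_cong refl image_cong s_image)
      finally show ?thesis by (simp add: copies_def)
    qed
    moreover have "\<pi> ` X = {..<card X}" using \<pi> by (auto simp: bij_betw_def)
    ultimately show ?thesis by simp
  qed
  define f where "f = (\<lambda>j. P (copies {..<j}))"
  have sub: "(\<lambda>T. idx (Min T)) ` copies {..<m} \<subseteq> {..<m}" using idx_Min by (auto simp: copies_def)
  have f: "P {T \<in> copies {..<m}. idx (Min T) \<in> X} = f (card X)" if "X \<subseteq> {..<m}" for X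
    using restrict[OF that] symmetric[OF that] by (simp add: f_def)
  obtain Q where Q: "degree Q \<le> 2 * N_deg V P" "separates (card {..<m}) f Q"
    using symmetric_restriction_separates[OF finV copies_V[OF order.refl] sub, of P f] f by auto
  obtain Q' where Q': "degree Q' \<le> 2 * N_deg V (\<lambda>H. \<not> P H)" "separates (card {..<m}) (\<lambda>j. \<not> f j) Q'"
    using symmetric_restriction_separates[OF finV copies_V[OF order.refl] sub, of "\<lambda>H. \<not> P H" "\<lambda>j. \<not> f j"] f
    by auto
  \<comment> \<open>At least one copy fits, so both counts \<open>0\<close> and \<open>1\<close> are
    available; they witness that \<open>f\<close> is not constant.\<close>
  have "1 \<le> m" using \<open>w \<le> n\<close> \<open>w > 0\<close> by (simp add: m_def div_greater_zero_iff Suc_le_eq)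
  have "\<not> f 0" using assms by (simp add: f_def copies_def)
  have "copies {..<1} = (`) (\<phi> 0) ` H" by (auto simp: copies_def)
  moreover have "P ((`) (\<phi> 0) ` H) = P H"
    using \<open>1 \<le> m\<close> \<phi>_inj \<phi>_range unfolding W_def
    by (intro hypergraph_property_inj_image[OF inv H(1)] image_subsetI) simp_all
  ultimately have "f 1" using H(2) by (simp only: f_def)
  have "m < (D + 1) * (4 * D\<^sup>2 + 1)"
  proof (rule separates_nonconstant_bound)
    show "degree Q \<le> D" "degree Q' \<le> D" using Q Q' degs by auto
    show "separates m f Q" "separates m (\<lambda>j. \<not> f j) Q'" using Q Q' by auto
    show "0 \<le> m" "1 \<le> m" "f 0 \<noteq> f 1" using \<open>1 \<le> m\<close> \<open>\<not> f 0\<close> \<open>f 1\<close> by auto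
  qed
  have "n < (m + 1) * w"
    using dividend_less_div_times[OF \<open>w > 0\<close>, of n] by (simp add: m_def algebra_simps)
  also have "\<dots> \<le> (D + 1) * (4 * D\<^sup>2 + 1) * (k * (4 * D\<^sup>2))"
    using w_le \<open>m < _\<close> by (intro mult_mono) auto
  finally show ?thesis by simp
qed

section \<open>The final bound on the number of vertices\<close>

lemma M_deg_not: "M_deg n k (\<lambda>H. \<not> P H) = M_deg n k P"
  by (simp add: M_deg_def max.commute)

lemma hypergraph_property_order_le:
  assumes "k \<ge> 1" "hypergraph_property n k P" "nonconstant_on n k P"
  shows "n \<le> 1280 * k * M_deg n k P ^ 6"
proof -
  define d where "d = M_deg n k P"
  \<comment> \<open>Normalizes the property to fail on the empty hypergraph; \<open>P'\<close> is
    \<open>P\<close> or its negation, and \<open>M_deg\<close> does not distinguish them.\<close>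
  define P' where "P' = (\<lambda>H. P H \<noteq> P {})"
  have P': "hypergraph_property n k P'"
    using assms(2) unfolding hypergraph_property_def P'_def by blast
  have "P' = P \<or> P' = (\<lambda>H. \<not> P H)" by (auto simp: P'_def fun_eq_iff)
  then have M: "M_deg n k P' = d" using M_deg_not by (auto simp: d_def)
  have "\<exists>H. H \<subseteq> ksets n k \<and> P' H"
    using assms(3) unfolding nonconstant_on_def P'_def by metis
  then obtain H where H: "H \<subseteq> ksets n k" "P' H"
    and min: "\<And>H'. H' \<subseteq> ksets n k \<and> P' H' \<Longrightarrow> card H \<le> card H'"
    using exists_least_iff[of "\<lambda>c. \<exists>H. H \<subseteq> ksets n k \<and> P' H \<and> card H = c"]
    by (metis linorder_le_less_linear)
  have "\<not> P' H'" if "H' \<subset> H" for H'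
  proof
    assume "P' H'"
    then have "card H \<le> card H'" using min that H by auto
    moreover have "card H' < card H"
      using that H finite_ksets by (intro psubset_card_mono) (auto intro: finite_subset)
    ultimately show False by simp
  qed
  then have n: "n \<le> (2 * d + 1) * (4 * (2 * d)\<^sup>2 + 1) * (k * (4 * (2 * d)\<^sup>2))"
    using hypergraph_property_order_bound[OF assms(1) P' H] M by (simp add: P'_def)
  show ?thesis
  proof (cases "d = 0")
    case True
    then show ?thesis using n by simp
  next
    case False
    then have "1 \<le> d" by simp
    then have "1 \<le> d\<^sup>2" by simp
    have "4 * (2 * d)\<^sup>2 = 16 * d\<^sup>2" by (simp add: power2_eq_square)
    then have "n \<le> (2 * d + 1) * (16 * d\<^sup>2 + 1) * (k * (16 * d\<^sup>2))" using n by simp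
    \<comment> \<open>For \<open>d \<ge> 1\<close> the lower-order terms are absorbed, giving a
      fifth power; the sixth power below is a weakening to the exponent of the theorem.\<close>
    also have "\<dots> \<le> (4 * d) * (20 * d\<^sup>2) * (k * (16 * d\<^sup>2))"
      using \<open>1 \<le> d\<close> \<open>1 \<le> d\<^sup>2\<close> by (intro mult_right_mono mult_mono) linarith+
    also have "\<dots> = 1280 * k * d ^ 5" by (simp add: power2_eq_square power_numeral_reduce)
    also have "\<dots> \<le> 1280 * k * d ^ 6" using \<open>1 \<le> d\<close> by (intro mult_left_mono power_increasing) auto
    finally show ?thesis by (simp add: d_def)
  qed
qed

theorem theorem3p28:
  fixes k :: nat
  assumes "k \<ge> 1"
  shows "\<exists>c>0. \<exists>n0. \<forall>n\<ge>n0. \<forall>P. hypergraph_property n k P \<and> nonconstant_on n k P \<longrightarrow>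
           real (M_deg n k P) \<ge> c * real n powr (1/6)"
proof -
  define C where "C = 1280 * real k"
  have C: "C > 0" using assms by (simp add: C_def)
  \<comment> \<open>Solving \<open>n \<le> C * M^6\<close> for \<open>M\<close> gives this constant,
    which depends on \<open>k\<close> only.\<close>
  define c where "c = C powr (-1/6)"
  have "c > 0" using C by (simp add: c_def)
  moreover have "c * real n powr (1/6) \<le> real (M_deg n k P)"
    if "hypergraph_property n k P" "nonconstant_on n k P" for n P
  proof -
    let ?d = "real (M_deg n k P)"
    have "real n \<le> real (1280 * k * M_deg n k P ^ 6)"
      using hypergraph_property_order_le[OF assms that] by (rule of_nat_mono)
    then have "real n \<le> C * ?d ^ 6" by (simp add: C_def)
    then have "real n powr (1/6) \<le> (C * ?d ^ 6) powr (1/6)" by (intro powr_mono2) auto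
    also have "\<dots> = C powr (1/6) * (?d ^ 6) powr (1/6)" using C by (simp add: powr_mult)
    also have "(?d ^ 6) powr (1/6) = ?d"
    proof (cases "?d = 0")
      case False
      then have "?d ^ 6 = ?d powr 6" by (simp add: powr_numeral)
      then show ?thesis using False by (simp only: powr_powr) simp
    qed simp
    finally have "c * real n powr (1/6) \<le> c * (C powr (1/6) * ?d)"
      using \<open>c > 0\<close> by (intro mult_left_mono) auto
    also have "\<dots> = ?d" using C by (simp add: c_def powr_minus field_simps)
    finally show ?thesis .
  qed
  ultimately show ?thesis by blast
qed

end
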